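(* Each of the four families of square-matrix-valued real rational functions $\mathcal{P}$, $\mathcal{B}$, $\mathcal{DP}$ and $\mathcal{DB}$ is matrix-convex. That is, let $\mathcal{F}$ be any one of these four families (containing functions of all matrix sizes). Then for all natural numbers $\nu$ and $k$, all $\eta_1,\dots,\eta_k\in\{1,\dots,\nu\}$, all matrices $\Upsilon_j\in\mathbb{C}^{\eta_j\times\nu}$ ($j=1,\dots,k$) with $\sum_{j=1}^k\Upsilon_j^*\Upsilon_j=I_\nu$, and all $F_1,\dots,F_k\in\mathcal{F}$ with $F_j$ being $\eta_j\times\eta_j$-valued, the $\nu\times\nu$-valued rational function $$\sum_{j=1}^k\Upsilon_j^*F_j(z)\Upsilon_j$$ belongs to $\mathcal{F}$.
   Context: $\overline{\mathbf{P}}_m$ denotes the set of $m\times m$ Hermitian positive semi-definite matrices; $X^*$ is the conjugate transpose. $\mathbb{C}_R=\{z\in\mathbb{C}:\operatorname{Re}z>0\}$ and $\overline{\mathbb{D}}^c=\{z\in\mathbb{C}:|z|>1\}$. Let $\overline{\mathbf{L}}_{I_m}=\{X\in\mathbb{C}^{m\times m}: X+X^*\in\overline{\mathbf{P}}_m\}$ and $\overline{\mathbf{S}}_{I_m}=\{X\in\mathbb{C}^{m\times m}: \|X\|_2\le 1\}$ ($\|\cdot\|_2$ is the spectral norm). A real rational function is a rational function with real coefficients. For an $m\times m$-valued real rational function $F$ of a complex variable $z$ ($m$ any natural number): - $F\in\mathcal{P}$ (Positive-Real) means $F$ is analytic in $\mathbb{C}_R$ and $F(z)\in\overline{\mathbf{L}}_{I_m}$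 for all $z\in\mathbb{C}_R$; - $F\in\mathcal{B}$ (Bounded-Real) means $F$ is analytic in $\mathbb{C}_R$ and $F(z)\in\overline{\mathbf{S}}_{I_m}$ for all $z\in\mathbb{C}_R$; - $F\in\mathcal{DP}$ (Discrete-Time-Positive-Real) means $F$ is analytic in $\overline{\mathbb{D}}^c$ and $F(z)\in\overline{\mathbf{L}}_{I_m}$ for all $z\in\overline{\mathbb{D}}^c$; - $F\in\mathcal{DB}$ (Discrete-Time-Bounded-Real) means $F$ is analytic in $\overline{\mathbb{D}}^c$ and $F(z)\in\overline{\mathbf{S}}_{I_m}$ for all $z\in\overline{\mathbb{D}}^c$.
   Formalization: As stated false: complex weights can destroy real coefficients (F=[[0,1],[-1,0]], Υ=diag(1,i)). Proved instead: real weights preserve each real family; complex weights preserve all conditions except realness of coefficients; the complex-coefficient families are matrix-convex. *)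

theory Defs
  imports "HOL-Analysis.Analysis" "Jordan_Normal_Form.Schur_Decomposition"
begin

definition psd_matrices :: "nat \<Rightarrow> complex mat set" where
  "psd_matrices m = {X \<in> carrier_mat m m.
     mat_adjoint X = X \<and> (\<forall>v \<in> carrier_vec m. 0 \<le> (X *\<^sub>v v) \<bullet>c v)}"

definition vec_norm2 :: "complex Matrix.vec \<Rightarrow> real" where
  "vec_norm2 v = L2_set (\<lambda>i. cmod (v $ i)) {..<dim_vec v}"

definition spectral_norm :: "complex mat \<Rightarrow> real" where
  "spectral_norm X = Sup {vec_norm2 (X *\<^sub>v v) | v. v \<in> carrier_vec (dim_col X) \<and> vec_norm2 v \<le> 1}"

definition lyapunov_set :: "nat \<Rightarrow> complex mat set" where
  "lyapunov_set m = {X \<in> carrier_mat m m. X + mat_adjoint X \<in> psd_matrices m}"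

definition stein_set :: "nat \<Rightarrow> complex mat set" where
  "stein_set m = {X \<in> carrier_mat m m. spectral_norm X \<le> 1}"

text \<open>
  A rational function is represented by a total function that agrees with a quotient of
  polynomials wherever the denominator does not vanish; its values at the remaining finitely many
  points are irrelevant. Where analyticity is demanded below, it forces the
  function to take the correct values and excludes poles.

  The parameter \<open>K\<close> is the set of admissible coefficients: \<open>\<real>\<close> for real rational functions,
  \<open>UNIV\<close> for rational functions with complex coefficients.
\<close>

definition rational_mat_fun :: "complex set \<Rightarrow> nat \<Rightarrow> (complex \<Rightarrow> complex mat) set" where
  "rational_mat_fun K m = {F. (\<forall>z. F z \<in> carrier_mat m m) \<and>
     (\<forall>i<m. \<forall>j<m. \<exists>p q. set (coeffs p) \<subseteq> K \<and> set (coeffs q) \<subseteq> K \<and> q \<noteq> 0 \<and>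
        (\<forall>z. poly q z \<noteq> 0 \<longrightarrow> F z $$ (i, j) = poly p z / poly q z))}"

definition mat_analytic_on :: "nat \<Rightarrow> (complex \<Rightarrow> complex mat) \<Rightarrow> complex set \<Rightarrow> bool" where
  "mat_analytic_on m F S \<longleftrightarrow> (\<forall>i<m. \<forall>j<m. (\<lambda>z. F z $$ (i, j)) analytic_on S)"

definition right_half_plane :: "complex set" where
  "right_half_plane = {z. Re z > 0}"

definition exterior_disc :: "complex set" where
  "exterior_disc = {z. cmod z > 1}"

definition positive_real :: "complex set \<Rightarrow> nat \<Rightarrow> (complex \<Rightarrow> complex mat) set" where
  "positive_real K m = {F \<in> rational_mat_fun K m.
     mat_analytic_on m F right_half_plane \<and> (\<forall>z \<in> right_half_plane. F z \<in> lyapunov_set m)}"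

definition bounded_real :: "complex set \<Rightarrow> nat \<Rightarrow> (complex \<Rightarrow> complex mat) set" where
  "bounded_real K m = {F \<in> rational_mat_fun K m.
     mat_analytic_on m F right_half_plane \<and> (\<forall>z \<in> right_half_plane. F z \<in> stein_set m)}"

definition discrete_positive_real :: "complex set \<Rightarrow> nat \<Rightarrow> (complex \<Rightarrow> complex mat) set" where
  "discrete_positive_real K m = {F \<in> rational_mat_fun K m.
     mat_analytic_on m F exterior_disc \<and> (\<forall>z \<in> exterior_disc. F z \<in> lyapunov_set m)}"

definition discrete_bounded_real :: "complex set \<Rightarrow> nat \<Rightarrow> (complex \<Rightarrow> complex mat) set" where
  "discrete_bounded_real K m = {F \<in> rational_mat_fun K m.
     mat_analytic_on m F exterior_disc \<and> (\<forall>z \<in> exterior_disc. F z \<in> stein_set m)}"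

definition mat_sum :: "nat \<Rightarrow> nat \<Rightarrow> (nat \<Rightarrow> complex mat) \<Rightarrow> complex mat" where
  "mat_sum n k A = mat n n (\<lambda>(r, c). \<Sum>j=1..k. A j $$ (r, c))"

text \<open>
  The \<open>\<nu> \<times> \<nu>\<close>-valued matrix-convex combinations of members of a family \<open>\<F>\<close> (indexed by matrix
  size) whose weights \<open>\<Upsilon>\<^sub>j\<close> have entries in \<open>K\<close>. Complex weights can turn real
  rational functions into ones with non-real coefficients: the constant function with value
  \<open>F = (0, 1; -1, 0)\<close> lies in all four families, but for the unitary weight \<open>\<Upsilon> = diag (1, \<i>)\<close> the
  combination \<open>\<Upsilon>\<^sup>* F \<Upsilon>\<close> equals \<open>(0, \<i>; \<i>, 0)\<close>. Hence the field of the weights is kept as a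
  parameter, to be matched with the field of the coefficients.
\<close>

definition matrix_combinations ::
  "complex set \<Rightarrow> (nat \<Rightarrow> (complex \<Rightarrow> complex mat) set) \<Rightarrow> nat \<Rightarrow> (complex \<Rightarrow> complex mat) set" where
  "matrix_combinations K \<F> \<nu> =
     {(\<lambda>z. mat_sum \<nu> k (\<lambda>j. mat_adjoint (\<Upsilon> j) * F j z * \<Upsilon> j)) | k \<eta> \<Upsilon> F.
        (\<forall>j\<in>{1..k}. \<eta> j \<in> {1..\<nu>} \<and> \<Upsilon> j \<in> carrier_mat (\<eta> j) \<nu> \<and> elements_mat (\<Upsilon> j) \<subseteq> K \<and>
                    F j \<in> \<F> (\<eta> j)) \<and>
        mat_sum \<nu> k (\<lambda>j. mat_adjoint (\<Upsilon> j) * \<Upsilon> j) = 1\<^sub>m \<nu>}"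

definition matrix_convex :: "complex set \<Rightarrow> (nat \<Rightarrow> (complex \<Rightarrow> complex mat) set) \<Rightarrow> bool" where
  "matrix_convex K \<F> \<longleftrightarrow> (\<forall>\<nu>. matrix_combinations K \<F> \<nu> \<subseteq> \<F> \<nu>)"

end

theory Submission
  imports Defs
begin

text \<open>
  Membership in any of the four families is decided by two independent kinds of conditions, both
  of which survive a combination \<open>\<Sum>\<^sub>j \<Upsilon>\<^sub>j\<^sup>* F\<^sub>j \<Upsilon>\<^sub>j\<close>.

  The entries of the combination are linear combinations of the entries of the \<open>F\<^sub>j\<close>, with
  coefficients that are products of a conjugated and an unconjugated entry of the weight \<open>\<Upsilon>\<^sub>j\<close>.
  Hence analyticity is inherited, and so is rationality over \<open>K\<close> as soon as \<open>K\<close> is closed under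
  sums, products and conjugation and contains the entries of the weights. Both \<open>\<real>\<close> and the
  complex plane qualify.

  The other condition is that the value at each point of the region lies in the Lyapunov or in
  the Stein set, so that it suffices to treat constant matrices. Everything rests on
  \<open>\<langle>(\<Sum>\<^sub>j \<Upsilon>\<^sub>j\<^sup>* X\<^sub>j \<Upsilon>\<^sub>j) v, w\<rangle> = \<Sum>\<^sub>j \<langle>X\<^sub>j (\<Upsilon>\<^sub>j v), \<Upsilon>\<^sub>j w\<rangle>\<close>
  (lemma \<open>matrix_combination_inner\<close>). For the Lyapunov set, where membership says
  \<open>Re \<langle>X v, v\<rangle> \<ge> 0\<close>, taking \<open>w = v\<close> exhibits a sum of nonnegative terms. For the Stein set,
  where membership says that \<open>X\<close> is a contraction, let \<open>w\<close> be the image of \<open>v\<close> under the combination.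
  Bounding each term by \<open>2 Re \<langle>a, b\<rangle> \<le> \<parallel>a\<parallel>\<^sup>2 + \<parallel>b\<parallel>\<^sup>2\<close> and using
  \<open>\<Sum>\<^sub>j \<parallel>\<Upsilon>\<^sub>j u\<parallel>\<^sup>2 = \<parallel>u\<parallel>\<^sup>2\<close>, which is what \<open>\<Sum>\<^sub>j \<Upsilon>\<^sub>j\<^sup>* \<Upsilon>\<^sub>j = I\<close> means, gives
  \<open>2 \<parallel>w\<parallel>\<^sup>2 \<le> \<parallel>v\<parallel>\<^sup>2 + \<parallel>w\<parallel>\<^sup>2\<close>, that is \<open>\<parallel>w\<parallel> \<le> \<parallel>v\<parallel>\<close>.

  Complex combinations of real rational functions need no separate argument: real coefficients are
  complex coefficients, so this case follows from the complex one by monotonicity.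
\<close>

(* Both the finite Cartesian products and the matrix library use the dollar sign for
   components; only the latter occur below. *)
unbundle no vec_syntax

section \<open>Hermitian forms of matrix combinations\<close>

lemma mat_adjoint_carrier [simp]:
  "A \<in> carrier_mat n m \<Longrightarrow> mat_adjoint A \<in> carrier_mat m n"
  by (auto simp: mat_adjoint_def)

lemma dim_mat_adjoint [simp]:
  "dim_row (mat_adjoint A) = dim_col A" "dim_col (mat_adjoint A) = dim_row A"
  by (auto simp: mat_adjoint_def)

lemma index_mat_adjoint:
  fixes A :: "complex mat"
  assumes "A \<in> carrier_mat n m" "i < m" "j < n"
  shows "mat_adjoint A $$ (i, j) = cnj (A $$ (j, i))"
  using assms by (auto simp: mat_adjoint_def mat_of_rows_index)

lemma mat_adjoint_inner:
  fixes A :: "complex mat"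
  assumes A: "A \<in> carrier_mat n m" and u: "u \<in> carrier_vec n" and w: "w \<in> carrier_vec m"
  shows "(mat_adjoint A *\<^sub>v u) \<bullet>c w = u \<bullet>c (A *\<^sub>v w)"
proof -
  have adj: "mat_adjoint A \<in> carrier_mat m n"
    using A by simp
  have "(mat_adjoint A *\<^sub>v u) \<bullet>c w =
      (\<Sum>i<m. \<Sum>j<n. cnj (A $$ (j, i)) * u $ j * cnj (w $ i))"
    using A adj u w
    by (simp add: scalar_prod_def sum_distrib_right index_mat_adjoint[OF A] lessThan_atLeast0)
  also have "\<dots> = (\<Sum>j<n. \<Sum>i<m. cnj (A $$ (j, i)) * u $ j * cnj (w $ i))"
    by (rule sum.swap)
  also have "\<dots> = u \<bullet>c (A *\<^sub>v w)"
    using A u w by (simp add: scalar_prod_def sum_distrib_left lessThan_atLeast0 mult_ac)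
  finally show ?thesis .
qed

lemma mat_sum_carrier [simp]: "mat_sum n k A \<in> carrier_mat n n"
  by (simp add: mat_sum_def)

lemma mat_sum_inner:
  assumes A: "\<And>j. j \<in> {1..k} \<Longrightarrow> A j \<in> carrier_mat n n"
    and v: "v \<in> carrier_vec n" and w: "w \<in> carrier_vec n"
  shows "(mat_sum n k A *\<^sub>v v) \<bullet>c w = (\<Sum>j=1..k. (A j *\<^sub>v v) \<bullet>c w)"
proof -
  have "(mat_sum n k A *\<^sub>v v) \<bullet>c w =
      (\<Sum>r<n. \<Sum>c<n. \<Sum>j=1..k. A j $$ (r, c) * v $ c * cnj (w $ r))"
    using v w
    by (simp add: mat_sum_def scalar_prod_def sum_distrib_right lessThan_atLeast0)
  also have "\<dots> = (\<Sum>r<n. \<Sum>j=1..k. \<Sum>c<n. A j $$ (r, c) * v $ c * cnj (w $ r))"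
    by (intro sum.cong refl sum.swap)
  also have "\<dots> = (\<Sum>j=1..k. \<Sum>r<n. \<Sum>c<n. A j $$ (r, c) * v $ c * cnj (w $ r))"
    by (rule sum.swap)
  also have "\<dots> = (\<Sum>j=1..k. (A j *\<^sub>v v) \<bullet>c w)"
  proof (intro sum.cong refl)
    fix j assume "j \<in> {1..k}"
    with A have "A j \<in> carrier_mat n n" by blast
    then show "(\<Sum>r<n. \<Sum>c<n. A j $$ (r, c) * v $ c * cnj (w $ r)) = (A j *\<^sub>v v) \<bullet>c w"
      using v w by (simp add: scalar_prod_def sum_distrib_right lessThan_atLeast0)
  qed
  finally show ?thesis .
qed

text \<open>
  Moving \<open>\<Upsilon>\<^sub>j\<^sup>*\<close> to the other side of the inner product turns a combination into a sum of forms of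
  the individual matrices, each evaluated at the transported vectors \<open>\<Upsilon>\<^sub>j v\<close> and \<open>\<Upsilon>\<^sub>j w\<close>.
\<close>
lemma matrix_combination_inner:
  assumes Y: "\<And>j. j \<in> {1..k} \<Longrightarrow> Y j \<in> carrier_mat (\<eta> j) n"
    and X: "\<And>j. j \<in> {1..k} \<Longrightarrow> X j \<in> carrier_mat (\<eta> j) (\<eta> j)"
    and v: "v \<in> carrier_vec n" and w: "w \<in> carrier_vec n"
  shows "(mat_sum n k (\<lambda>j. mat_adjoint (Y j) * X j * Y j) *\<^sub>v v) \<bullet>c w =
    (\<Sum>j=1..k. (X j *\<^sub>v (Y j *\<^sub>v v)) \<bullet>c (Y j *\<^sub>v w))"
proof -
  have "(mat_sum n k (\<lambda>j. mat_adjoint (Y j) * X j * Y j) *\<^sub>v v) \<bullet>c w =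
      (\<Sum>j=1..k. ((mat_adjoint (Y j) * X j * Y j) *\<^sub>v v) \<bullet>c w)"
  proof (rule mat_sum_inner[OF _ v w])
    fix j assume j: "j \<in> {1..k}"
    show "mat_adjoint (Y j) * X j * Y j \<in> carrier_mat n n"
      using Y[OF j] X[OF j] mat_adjoint_carrier[OF Y[OF j]] by (metis mult_carrier_mat)
  qed
  also have "\<dots> = (\<Sum>j=1..k. (X j *\<^sub>v (Y j *\<^sub>v v)) \<bullet>c (Y j *\<^sub>v w))"
  proof (intro sum.cong refl)
    fix j assume j: "j \<in> {1..k}"
    note Yj = Y[OF j] and Xj = X[OF j]
    have Yv: "Y j *\<^sub>v v \<in> carrier_vec (\<eta> j)"
      using Yj v by (rule mult_mat_vec_carrier)
    have "(mat_adjoint (Y j) * X j * Y j) *\<^sub>v v = mat_adjoint (Y j) * X j *\<^sub>v (Y j *\<^sub>v v)"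
      using mat_adjoint_carrier[OF Yj] Xj Yj v by (meson assoc_mult_mat_vec mult_carrier_mat)
    also have "\<dots> = mat_adjoint (Y j) *\<^sub>v (X j *\<^sub>v (Y j *\<^sub>v v))"
      using mat_adjoint_carrier[OF Yj] Xj Yv by (rule assoc_mult_mat_vec)
    finally show "((mat_adjoint (Y j) * X j * Y j) *\<^sub>v v) \<bullet>c w =
        (X j *\<^sub>v (Y j *\<^sub>v v)) \<bullet>c (Y j *\<^sub>v w)"
      using mat_adjoint_inner[OF Yj mult_mat_vec_carrier[OF Xj Yv] w] by simp
  qed
  finally show ?thesis .
qed

text \<open>
  Stacking the weights into one map \<open>v \<mapsto> (\<Upsilon>\<^sub>1 v, \<dots>, \<Upsilon>\<^sub>k v)\<close> yields an isometry. This is the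
  preceding identity applied to identity matrices.
\<close>
lemma matrix_weights_isometry:
  assumes Y: "\<And>j. j \<in> {1..k} \<Longrightarrow> Y j \<in> carrier_mat (\<eta> j) n"
    and one: "mat_sum n k (\<lambda>j. mat_adjoint (Y j) * Y j) = 1\<^sub>m n"
    and v: "v \<in> carrier_vec n" and w: "w \<in> carrier_vec n"
  shows "(\<Sum>j=1..k. (Y j *\<^sub>v v) \<bullet>c (Y j *\<^sub>v w)) = v \<bullet>c w"
proof -
  have "v \<bullet>c w = (mat_sum n k (\<lambda>j. mat_adjoint (Y j) * Y j) *\<^sub>v v) \<bullet>c w"
    using one v by simp
  also have "mat_sum n k (\<lambda>j. mat_adjoint (Y j) * Y j) =
      mat_sum n k (\<lambda>j. mat_adjoint (Y j) * 1\<^sub>m (\<eta> j) * Y j)"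
  proof -
    have "mat_adjoint (Y j) * 1\<^sub>m (\<eta> j) = mat_adjoint (Y j)" if "j \<in> {1..k}" for j
      using Y[OF that] by (intro right_mult_one_mat mat_adjoint_carrier)
    then show ?thesis
      by (simp add: mat_sum_def)
  qed
  also have "(\<dots> *\<^sub>v v) \<bullet>c w = (\<Sum>j=1..k. (1\<^sub>m (\<eta> j) *\<^sub>v (Y j *\<^sub>v v)) \<bullet>c (Y j *\<^sub>v w))"
    using Y v w by (intro matrix_combination_inner[where \<eta> = \<eta>]) auto
  also have "\<dots> = (\<Sum>j=1..k. (Y j *\<^sub>v v) \<bullet>c (Y j *\<^sub>v w))"
    using Y v by (intro sum.cong refl) (metis mult_mat_vec_carrier one_mult_mat_vec)
  finally show ?thesis ..
qed

section \<open>The value sets as conditions on the Hermitian form\<close>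

lemma inner_commute:
  assumes "dim_vec u = dim_vec w"
  shows "u \<bullet>c w = cnj (w \<bullet>c u)"
  using assms by (simp add: scalar_prod_def) (simp add: mult.commute)

text \<open>
  The form of \<open>X + X\<^sup>*\<close> is \<open>\<langle>X v, v\<rangle>\<close> plus its conjugate, so it is automatically real and equals
  \<open>2 Re \<langle>X v, v\<rangle>\<close>.
\<close>
lemma lyapunov_set_iff:
  "X \<in> lyapunov_set m \<longleftrightarrow>
     X \<in> carrier_mat m m \<and> (\<forall>v \<in> carrier_vec m. 0 \<le> Re ((X *\<^sub>v v) \<bullet>c v))"
proof (cases "X \<in> carrier_mat m m")
  case X: True
  then have X': "mat_adjoint X \<in> carrier_mat m m" by simp
  have herm: "mat_adjoint (X + mat_adjoint X) = X + mat_adjoint X"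
  proof (rule eq_matI)
    have S: "X + mat_adjoint X \<in> carrier_mat m m" using X X' by simp
    show "dim_row (mat_adjoint (X + mat_adjoint X)) = dim_row (X + mat_adjoint X)"
      "dim_col (mat_adjoint (X + mat_adjoint X)) = dim_col (X + mat_adjoint X)"
      using X by auto
    fix i j assume "i < dim_row (X + mat_adjoint X)" "j < dim_col (X + mat_adjoint X)"
    then have ij: "i < m" "j < m" using X X' by auto
    then show "mat_adjoint (X + mat_adjoint X) $$ (i, j) = (X + mat_adjoint X) $$ (i, j)"
      using X X' by (simp add: index_mat_adjoint[OF S] index_mat_adjoint[OF X])
  qed
  have form: "((X + mat_adjoint X) *\<^sub>v v) \<bullet>c v = of_real (2 * Re ((X *\<^sub>v v) \<bullet>c v))"
    if v: "v \<in> carrier_vec m" for v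
  proof -
    have "((X + mat_adjoint X) *\<^sub>v v) \<bullet>c v = (X *\<^sub>v v + mat_adjoint X *\<^sub>v v) \<bullet>c v"
      by (simp only: add_mult_distrib_mat_vec[OF X X' v])
    also have "\<dots> = (X *\<^sub>v v) \<bullet>c v + (mat_adjoint X *\<^sub>v v) \<bullet>c v"
      using mult_mat_vec_carrier[OF X v] mult_mat_vec_carrier[OF X' v] carrier_vec_conjugate[OF v]
      by (rule add_scalar_prod_distrib)
    also have "(mat_adjoint X *\<^sub>v v) \<bullet>c v = v \<bullet>c (X *\<^sub>v v)"
      using X v v by (rule mat_adjoint_inner)
    also have "\<dots> = cnj ((X *\<^sub>v v) \<bullet>c v)"
      using X v by (intro inner_commute) simp
    finally show ?thesis
      by (simp only: complex_add_cnj)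
  qed
  have "X \<in> lyapunov_set m \<longleftrightarrow>
      (\<forall>v \<in> carrier_vec m. 0 \<le> ((X + mat_adjoint X) *\<^sub>v v) \<bullet>c v)"
    using X X' herm by (simp add: lyapunov_set_def psd_matrices_def del: mat_adjoint_carrier)
  also have "\<dots> \<longleftrightarrow> (\<forall>v \<in> carrier_vec m. 0 \<le> Re ((X *\<^sub>v v) \<bullet>c v))"
    by (intro ball_cong refl) (simp only: form, simp add: less_eq_complex_def)
  finally show ?thesis using X by blast
qed (simp add: lyapunov_set_def)

lemma vec_norm2_nonneg [simp]: "0 \<le> vec_norm2 v"
  by (simp add: vec_norm2_def L2_set_nonneg)

lemma vec_norm2_smult: "vec_norm2 (c \<cdot>\<^sub>v v) = cmod c * vec_norm2 v"
proof -
  have "vec_norm2 (c \<cdot>\<^sub>v v) = L2_set (\<lambda>i. cmod c * cmod (v $ i)) {..<dim_vec v}"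
    unfolding vec_norm2_def by (rule L2_set_cong) (auto simp: norm_mult)
  then show ?thesis
    by (simp add: vec_norm2_def L2_set_right_distrib)
qed

lemma Re_inner_self: "Re (v \<bullet>c v) = (vec_norm2 v)\<^sup>2"
proof -
  have "Re (v \<bullet>c v) = (\<Sum>i<dim_vec v. (cmod (v $ i))\<^sup>2)"
    by (simp add: scalar_prod_def lessThan_atLeast0 cmod_power2 flip: power2_eq_square)
  also have "\<dots> = (vec_norm2 v)\<^sup>2"
    by (simp add: vec_norm2_def L2_set_def sum_nonneg)
  finally show ?thesis .
qed

text \<open>
  A crude bound suffices: it makes the supremum that defines the spectral norm one of a bounded
  set, which a real supremum needs in order to be an upper bound, and it shows that vectors of
  norm zero have images of norm zero.
\<close>
lemma vec_norm2_mult_mat_le: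
  "\<exists>C. \<forall>v \<in> carrier_vec (dim_col X). vec_norm2 (X *\<^sub>v v) \<le> C * vec_norm2 v"
proof (intro exI ballI)
  fix v :: "complex Matrix.vec" assume v: "v \<in> carrier_vec (dim_col X)"
  have "vec_norm2 (X *\<^sub>v v) \<le> (\<Sum>i<dim_row X. \<bar>cmod ((X *\<^sub>v v) $ i)\<bar>)"
    unfolding vec_norm2_def dim_mult_mat_vec by (rule L2_set_le_sum_abs)
  also have "\<dots> \<le> (\<Sum>i<dim_row X. \<Sum>j<dim_col X. cmod (X $$ (i, j)) * vec_norm2 v)"
  proof (rule sum_mono)
    fix i assume "i \<in> {..<dim_row X}"
    then have i: "i < dim_row X" by simp
    have "\<bar>cmod ((X *\<^sub>v v) $ i)\<bar> = cmod (\<Sum>j<dim_col X. X $$ (i, j) * v $ j)"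
      using v i by (simp add: scalar_prod_def lessThan_atLeast0)
    also have "\<dots> \<le> (\<Sum>j<dim_col X. cmod (X $$ (i, j)) * cmod (v $ j))"
      by (rule order_trans[OF norm_sum]) (simp add: norm_mult)
    also have "\<dots> \<le> (\<Sum>j<dim_col X. cmod (X $$ (i, j)) * vec_norm2 v)"
    proof (intro sum_mono mult_left_mono)
      fix j assume "j \<in> {..<dim_col X}"
      then show "cmod (v $ j) \<le> vec_norm2 v"
        unfolding vec_norm2_def using v by (intro member_le_L2_set) auto
    qed simp
    finally show "\<bar>cmod ((X *\<^sub>v v) $ i)\<bar> \<le> \<dots>" .
  qed
  also have "\<dots> = (\<Sum>i<dim_row X. \<Sum>j<dim_col X. cmod (X $$ (i, j))) * vec_norm2 v"
    by (simp add: sum_distrib_right)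
  finally show "vec_norm2 (X *\<^sub>v v) \<le> \<dots>" .
qed

text \<open>
  The forward direction is homogeneity: the supremum bounds the image of the normalised vector
  \<open>v / \<parallel>v\<parallel>\<close>.
\<close>
lemma spectral_norm_le_1_iff:
  "spectral_norm X \<le> 1 \<longleftrightarrow>
     (\<forall>v \<in> carrier_vec (dim_col X). vec_norm2 (X *\<^sub>v v) \<le> vec_norm2 v)"
    (is "_ \<longleftrightarrow> ?contr")
proof
  let ?S = "{vec_norm2 (X *\<^sub>v v) | v. v \<in> carrier_vec (dim_col X) \<and> vec_norm2 v \<le> 1}"
  obtain C where C: "\<And>v. v \<in> carrier_vec (dim_col X) \<Longrightarrow> vec_norm2 (X *\<^sub>v v) \<le> C * vec_norm2 v"
    using vec_norm2_mult_mat_le by blast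
  show ?contr if le: "spectral_norm X \<le> 1"
  proof
    fix v :: "complex Matrix.vec" assume v: "v \<in> carrier_vec (dim_col X)"
    show "vec_norm2 (X *\<^sub>v v) \<le> vec_norm2 v"
    proof (cases "vec_norm2 v = 0")
      case True
      then show ?thesis using C[OF v] by simp
    next
      case False
      then have pos: "vec_norm2 v > 0"
        using vec_norm2_nonneg[of v] by linarith
      let ?u = "complex_of_real (1 / vec_norm2 v) \<cdot>\<^sub>v v"
      have "bdd_above ?S"
      proof (rule bdd_aboveI)
        fix x assume "x \<in> ?S"
        then obtain u where u: "u \<in> carrier_vec (dim_col X)" "vec_norm2 u \<le> 1"
          and x: "x = vec_norm2 (X *\<^sub>v u)" by blast
        have "C * vec_norm2 u \<le> \<bar>C\<bar> * 1"
          using u by (intro mult_mono) auto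
        then show "x \<le> \<bar>C\<bar>" using C[OF u(1)] x by simp
      qed
      moreover have "vec_norm2 (X *\<^sub>v ?u) \<in> ?S"
      proof -
        have "?u \<in> carrier_vec (dim_col X)" "vec_norm2 ?u \<le> 1"
          using v pos by (simp_all add: vec_norm2_smult norm_divide)
        then show ?thesis by blast
      qed
      ultimately have "vec_norm2 (X *\<^sub>v ?u) \<le> Sup ?S"
        by (intro cSup_upper)
      then have "vec_norm2 (X *\<^sub>v ?u) \<le> 1"
        using le unfolding spectral_norm_def by linarith
      moreover have "X *\<^sub>v ?u = complex_of_real (1 / vec_norm2 v) \<cdot>\<^sub>v (X *\<^sub>v v)"
        using v by (intro mult_mat_vec) auto
      ultimately show ?thesis
        using pos by (simp add: vec_norm2_smult norm_divide field_simps)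
    qed
  qed
  show "spectral_norm X \<le> 1" if contr: ?contr
    unfolding spectral_norm_def
  proof (rule cSup_least)
    have "vec_norm2 (0\<^sub>v (dim_col X)) \<le> 1"
      by (simp add: vec_norm2_def L2_set_def)
    then show "?S \<noteq> {}" using zero_carrier_vec by blast
    show "x \<le> 1" if "x \<in> ?S" for x
    proof -
      from that obtain v where "v \<in> carrier_vec (dim_col X)" "vec_norm2 v \<le> 1"
        and "x = vec_norm2 (X *\<^sub>v v)" by blast
      with contr show ?thesis by (meson order_trans)
    qed
  qed
qed

lemma stein_set_iff:
  "X \<in> stein_set m \<longleftrightarrow>
     X \<in> carrier_mat m m \<and> (\<forall>v \<in> carrier_vec m. vec_norm2 (X *\<^sub>v v) \<le> vec_norm2 v)"
  by (auto simp: stein_set_def spectral_norm_le_1_iff)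

section \<open>Matrix-convexity of the value sets\<close>

text \<open>
  Matrix-convexity of a family of sets of constant matrices, one set for each size, with arbitrary
  complex weights.
\<close>
definition matrix_convex_set :: "(nat \<Rightarrow> complex mat set) \<Rightarrow> bool" where
  "matrix_convex_set V \<longleftrightarrow> (\<forall>n k \<eta> Y X.
     (\<forall>j\<in>{1..k}. Y j \<in> carrier_mat (\<eta> j) n \<and> X j \<in> V (\<eta> j)) \<longrightarrow>
     mat_sum n k (\<lambda>j. mat_adjoint (Y j) * Y j) = 1\<^sub>m n \<longrightarrow>
     mat_sum n k (\<lambda>j. mat_adjoint (Y j) * X j * Y j) \<in> V n)"

lemma matrix_convex_set_lyapunov: "matrix_convex_set lyapunov_set"
  unfolding matrix_convex_set_def
proof (intro allI impI)
  fix n k :: nat and \<eta> :: "nat \<Rightarrow> nat" and Y X :: "nat \<Rightarrow> complex mat"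
  assume YX: "\<forall>j\<in>{1..k}. Y j \<in> carrier_mat (\<eta> j) n \<and> X j \<in> lyapunov_set (\<eta> j)"
  then have Y: "\<And>j. j \<in> {1..k} \<Longrightarrow> Y j \<in> carrier_mat (\<eta> j) n"
    and X: "\<And>j. j \<in> {1..k} \<Longrightarrow> X j \<in> carrier_mat (\<eta> j) (\<eta> j)"
    by (simp_all add: lyapunov_set_def)
  let ?S = "mat_sum n k (\<lambda>j. mat_adjoint (Y j) * X j * Y j)"
  have "0 \<le> Re ((?S *\<^sub>v v) \<bullet>c v)" if v: "v \<in> carrier_vec n" for v
  proof -
    have "0 \<le> (\<Sum>j=1..k. Re ((X j *\<^sub>v (Y j *\<^sub>v v)) \<bullet>c (Y j *\<^sub>v v)))"
    proof (rule sum_nonneg)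
      fix j assume j: "j \<in> {1..k}"
      have "Y j *\<^sub>v v \<in> carrier_vec (\<eta> j)"
        using Y[OF j] v by (rule mult_mat_vec_carrier)
      then show "0 \<le> Re ((X j *\<^sub>v (Y j *\<^sub>v v)) \<bullet>c (Y j *\<^sub>v v))"
        using YX j lyapunov_set_iff by blast
    qed
    moreover have "(?S *\<^sub>v v) \<bullet>c v =
        (\<Sum>j=1..k. (X j *\<^sub>v (Y j *\<^sub>v v)) \<bullet>c (Y j *\<^sub>v v))"
      by (rule matrix_combination_inner) (fact Y X v)+
    ultimately show ?thesis
      by (simp only: Re_sum)
  qed
  then show "?S \<in> lyapunov_set n"
    by (simp add: lyapunov_set_iff)
qed

text \<open>
  This expands \<open>0 \<le> \<parallel>u - w\<parallel>\<^sup>2\<close> entry by entry. In the next proof it takes the place of the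
  Cauchy--Schwarz inequality: unlike a product of norms, its right-hand side can be summed over the
  weights directly by means of the isometry.
\<close>
lemma Re_inner_le:
  assumes u: "u \<in> carrier_vec n" and w: "w \<in> carrier_vec n"
  shows "2 * Re (u \<bullet>c w) \<le> (vec_norm2 u)\<^sup>2 + (vec_norm2 w)\<^sup>2"
proof -
  have "2 * Re (a * cnj b) \<le> (cmod a)\<^sup>2 + (cmod b)\<^sup>2" for a b
  proof -
    have "0 \<le> (Re a - Re b)\<^sup>2 + (Im a - Im b)\<^sup>2" by simp
    then show ?thesis
      unfolding cmod_power2 by (simp add: power2_eq_square algebra_simps)
  qed
  then have "(\<Sum>i<n. 2 * Re (u $ i * cnj (w $ i))) \<le> (\<Sum>i<n. (cmod (u $ i))\<^sup>2 + (cmod (w $ i))\<^sup>2)"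
    by (intro sum_mono)
  then show ?thesis
    using u w by (simp add: scalar_prod_def lessThan_atLeast0 sum_distrib_left sum.distrib
        vec_norm2_def L2_set_def sum_nonneg)
qed

text \<open>
  Pairing the image \<open>w\<close> of \<open>v\<close> with itself keeps the estimate free of square roots: the resulting
  term \<open>\<parallel>w\<parallel>\<^sup>2\<close> on the right is absorbed on the left.
\<close>
lemma matrix_convex_set_stein: "matrix_convex_set stein_set"
  unfolding matrix_convex_set_def
proof (intro allI impI)
  fix n k :: nat and \<eta> :: "nat \<Rightarrow> nat" and Y X :: "nat \<Rightarrow> complex mat"
  assume YX: "\<forall>j\<in>{1..k}. Y j \<in> carrier_mat (\<eta> j) n \<and> X j \<in> stein_set (\<eta> j)"
    and one: "mat_sum n k (\<lambda>j. mat_adjoint (Y j) * Y j) = 1\<^sub>m n"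
  then have Y: "\<And>j. j \<in> {1..k} \<Longrightarrow> Y j \<in> carrier_mat (\<eta> j) n"
    and X: "\<And>j. j \<in> {1..k} \<Longrightarrow> X j \<in> carrier_mat (\<eta> j) (\<eta> j)"
    by (simp_all add: stein_set_def)
  let ?S = "mat_sum n k (\<lambda>j. mat_adjoint (Y j) * X j * Y j)"
  have iso: "(\<Sum>j=1..k. (vec_norm2 (Y j *\<^sub>v v))\<^sup>2) = (vec_norm2 v)\<^sup>2"
    if v: "v \<in> carrier_vec n" for v
  proof -
    have "(\<Sum>j=1..k. (Y j *\<^sub>v v) \<bullet>c (Y j *\<^sub>v v)) = v \<bullet>c v"
      by (rule matrix_weights_isometry) (fact Y one v)+
    then have "(\<Sum>j=1..k. Re ((Y j *\<^sub>v v) \<bullet>c (Y j *\<^sub>v v))) = Re (v \<bullet>c v)"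
      by (simp only: Re_sum[symmetric])
    then show ?thesis by (simp only: Re_inner_self)
  qed
  have "vec_norm2 (?S *\<^sub>v v) \<le> vec_norm2 v" if v: "v \<in> carrier_vec n" for v
  proof -
    define w where "w = ?S *\<^sub>v v"
    have w: "w \<in> carrier_vec n"
      unfolding w_def using mat_sum_carrier v by (rule mult_mat_vec_carrier)
    have "(?S *\<^sub>v v) \<bullet>c w = (\<Sum>j=1..k. (X j *\<^sub>v (Y j *\<^sub>v v)) \<bullet>c (Y j *\<^sub>v w))"
      by (rule matrix_combination_inner) (fact Y X v w)+
    then have "w \<bullet>c w = (\<Sum>j=1..k. (X j *\<^sub>v (Y j *\<^sub>v v)) \<bullet>c (Y j *\<^sub>v w))"
      by (simp only: w_def[symmetric])
    then have "2 * (vec_norm2 w)\<^sup>2 =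
        (\<Sum>j=1..k. 2 * Re ((X j *\<^sub>v (Y j *\<^sub>v v)) \<bullet>c (Y j *\<^sub>v w)))"
      by (simp flip: Re_inner_self add: sum_distrib_left)
    also have "\<dots> \<le> (\<Sum>j=1..k. (vec_norm2 (Y j *\<^sub>v v))\<^sup>2 + (vec_norm2 (Y j *\<^sub>v w))\<^sup>2)"
    proof (rule sum_mono)
      fix j assume "j \<in> {1..k}"
      with YX have Yj: "Y j \<in> carrier_mat (\<eta> j) n" and Xj: "X j \<in> carrier_mat (\<eta> j) (\<eta> j)"
        and contr: "\<forall>u \<in> carrier_vec (\<eta> j). vec_norm2 (X j *\<^sub>v u) \<le> vec_norm2 u"
        by (auto simp: stein_set_iff)
      have Yv: "Y j *\<^sub>v v \<in> carrier_vec (\<eta> j)" and Yw: "Y j *\<^sub>v w \<in> carrier_vec (\<eta> j)"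
        using Yj v w by auto
      have "2 * Re ((X j *\<^sub>v (Y j *\<^sub>v v)) \<bullet>c (Y j *\<^sub>v w)) \<le>
          (vec_norm2 (X j *\<^sub>v (Y j *\<^sub>v v)))\<^sup>2 + (vec_norm2 (Y j *\<^sub>v w))\<^sup>2"
        using mult_mat_vec_carrier[OF Xj Yv] Yw by (rule Re_inner_le)
      also have "\<dots> \<le> (vec_norm2 (Y j *\<^sub>v v))\<^sup>2 + (vec_norm2 (Y j *\<^sub>v w))\<^sup>2"
        using contr Yv by (simp add: power_mono)
      finally show "2 * Re ((X j *\<^sub>v (Y j *\<^sub>v v)) \<bullet>c (Y j *\<^sub>v w)) \<le> \<dots>" .
    qed
    also have "\<dots> = (vec_norm2 v)\<^sup>2 + (vec_norm2 w)\<^sup>2"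
      by (simp add: sum.distrib iso v w del: One_nat_def)
    finally have "(vec_norm2 w)\<^sup>2 \<le> (vec_norm2 v)\<^sup>2" by simp
    then show ?thesis
      unfolding w_def by (rule power2_le_imp_le) simp
  qed
  then show "?S \<in> stein_set n"
    by (simp add: stein_set_iff)
qed

section \<open>Rational functions with coefficients in a conjugation-closed subsemiring\<close>

definition rational_fun :: "complex set \<Rightarrow> (complex \<Rightarrow> complex) \<Rightarrow> bool" where
  "rational_fun K f \<longleftrightarrow> (\<exists>p q. set (coeffs p) \<subseteq> K \<and> set (coeffs q) \<subseteq> K \<and> q \<noteq> 0 \<and>
     (\<forall>z. poly q z \<noteq> 0 \<longrightarrow> f z = poly p z / poly q z))"

lemma rational_mat_fun_iff:
  "F \<in> rational_mat_fun K m \<longleftrightarrow>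
     (\<forall>z. F z \<in> carrier_mat m m) \<and> (\<forall>i<m. \<forall>j<m. rational_fun K (\<lambda>z. F z $$ (i, j)))"
  by (simp add: rational_mat_fun_def rational_fun_def)

text \<open>
  Sums and products let the coefficient set absorb the arithmetic of polynomials; conjugation is
  there because \<open>\<Upsilon>\<^sub>j\<^sup>*\<close> has the conjugated entries of \<open>\<Upsilon>\<^sub>j\<close>.
\<close>
locale conj_subsemiring =
  fixes K :: "complex set"
  assumes zero: "0 \<in> K" and one: "1 \<in> K"
    and add: "a \<in> K \<Longrightarrow> b \<in> K \<Longrightarrow> a + b \<in> K"
    and mult: "a \<in> K \<Longrightarrow> b \<in> K \<Longrightarrow> a * b \<in> K"
    and cnj: "a \<in> K \<Longrightarrow> cnj a \<in> K"
begin

lemma sum_closed: "(\<And>x. x \<in> A \<Longrightarrow> g x \<in> K) \<Longrightarrow> sum g A \<in> K"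
  by (induction A rule: infinite_finite_induct) (simp_all add: zero add)

lemma coeffs_subset_iff: "set (coeffs p) \<subseteq> K \<longleftrightarrow> (\<forall>n. coeff p n \<in> K)"
proof -
  have "set (coeffs p) \<subseteq> K \<longleftrightarrow> range (coeff p) \<subseteq> K"
    using zero by (simp add: range_coeff)
  then show ?thesis by (simp add: image_subset_iff)
qed

lemma rational_fun_add:
  assumes "rational_fun K f" "rational_fun K g"
  shows "rational_fun K (\<lambda>z. f z + g z)"
proof -
  obtain p q where f: "\<forall>n. coeff p n \<in> K" "\<forall>n. coeff q n \<in> K" "q \<noteq> 0"
      "\<And>z. poly q z \<noteq> 0 \<Longrightarrow> f z = poly p z / poly q z"
    using assms(1) unfolding rational_fun_def coeffs_subset_iff by blast
  obtain r s where g: "\<forall>n. coeff r n \<in> K" "\<forall>n. coeff s n \<in> K" "s \<noteq> 0"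
      "\<And>z. poly s z \<noteq> 0 \<Longrightarrow> g z = poly r z / poly s z"
    using assms(2) unfolding rational_fun_def coeffs_subset_iff by blast
  have "\<forall>n. coeff (p * s + r * q) n \<in> K" "\<forall>n. coeff (q * s) n \<in> K"
    using f g by (auto simp: coeff_mult intro!: add sum_closed mult)
  then show ?thesis
    unfolding rational_fun_def coeffs_subset_iff
    using f g by (intro exI[of _ "p * s + r * q"] exI[of _ "q * s"]) (auto simp: add_frac_eq)
qed

lemma rational_fun_cmult:
  assumes "c \<in> K" "rational_fun K f"
  shows "rational_fun K (\<lambda>z. c * f z)"
proof -
  obtain p q where f: "\<forall>n. coeff p n \<in> K" "\<forall>n. coeff q n \<in> K" "q \<noteq> 0"
      "\<And>z. poly q z \<noteq> 0 \<Longrightarrow> f z = poly p z / poly q z"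
    using assms(2) unfolding rational_fun_def coeffs_subset_iff by blast
  then show ?thesis
    unfolding rational_fun_def coeffs_subset_iff
    using assms(1) by (intro exI[of _ "Polynomial.smult c p"] exI[of _ q]) (auto simp: mult)
qed

lemma rational_fun_0: "rational_fun K (\<lambda>_. 0)"
  unfolding rational_fun_def coeffs_subset_iff
  by (intro exI[of _ 0] exI[of _ 1]) (auto simp: zero one)

lemma rational_fun_sum:
  "(\<And>x. x \<in> A \<Longrightarrow> rational_fun K (f x)) \<Longrightarrow> rational_fun K (\<lambda>z. \<Sum>x\<in>A. f x z)"
proof (induction A rule: infinite_finite_induct)
  case (infinite A)
  then show ?case by (simp add: rational_fun_0)
next
  case empty
  show ?case by (simp add: rational_fun_0)
next
  case (insert x A)
  then show ?case by (simp add: rational_fun_add)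
qed

end

section \<open>Matrix-convexity of the function families\<close>

text \<open>
  Each entry of a combination is linear in the entries of the matrices being combined; the scalars
  stand to the left in each term, which is the form that the closure of rational functions under
  multiplication by constants applies to.
\<close>
lemma matrix_combination_index:
  assumes Y: "\<And>j. j \<in> {1..k} \<Longrightarrow> Y j \<in> carrier_mat (\<eta> j) n"
    and X: "\<And>j. j \<in> {1..k} \<Longrightarrow> X j \<in> carrier_mat (\<eta> j) (\<eta> j)"
    and rc: "r < n" "c < n"
  shows "mat_sum n k (\<lambda>j. mat_adjoint (Y j) * X j * Y j) $$ (r, c) =
    (\<Sum>j=1..k. \<Sum>b<\<eta> j. \<Sum>a<\<eta> j. cnj (Y j $$ (a, r)) * Y j $$ (b, c) * X j $$ (a, b))"
proof -
  have "(mat_adjoint (Y j) * X j * Y j) $$ (r, c) =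
      (\<Sum>b<\<eta> j. \<Sum>a<\<eta> j. cnj (Y j $$ (a, r)) * Y j $$ (b, c) * X j $$ (a, b))"
    if j: "j \<in> {1..k}" for j
  proof -
    note Yj = Y[OF j] and Xj = X[OF j]
    have A: "mat_adjoint (Y j) \<in> carrier_mat n (\<eta> j)" using Yj by simp
    have "(mat_adjoint (Y j) * X j * Y j) $$ (r, c) =
        (\<Sum>b<\<eta> j. (mat_adjoint (Y j) * X j) $$ (r, b) * Y j $$ (b, c))"
      using A Xj Yj rc by (simp add: scalar_prod_def lessThan_atLeast0 del: assoc_mult_mat)
    also have "\<dots> = (\<Sum>b<\<eta> j. \<Sum>a<\<eta> j. cnj (Y j $$ (a, r)) * Y j $$ (b, c) * X j $$ (a, b))"
      using A Xj Yj rc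
      by (intro sum.cong refl)
        (simp add: scalar_prod_def lessThan_atLeast0 sum_distrib_left sum_distrib_right
          index_mat_adjoint[OF Yj] mult_ac)
    finally show ?thesis .
  qed
  then show ?thesis
    using rc by (simp add: mat_sum_def)
qed

text \<open>
  The common shape of the four families: the region \<open>S\<close> is a half plane or the exterior of a disc,
  and \<open>V\<close> is the family of Lyapunov or Stein sets.
\<close>
definition mat_fun_family ::
  "complex set \<Rightarrow> (nat \<Rightarrow> complex mat set) \<Rightarrow> complex set \<Rightarrow> nat \<Rightarrow> (complex \<Rightarrow> complex mat) set" where
  "mat_fun_family S V K m =
     {F \<in> rational_mat_fun K m. mat_analytic_on m F S \<and> (\<forall>z \<in> S. F z \<in> V m)}"

text \<open>
  Rationality and analyticity are read off entry by entry; the condition on the values is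
  matrix-convexity of \<open>V\<close>, applied at each point of \<open>S\<close> separately.
\<close>
lemma (in conj_subsemiring) matrix_convex_mat_fun_family:
  assumes V: "matrix_convex_set V"
  shows "matrix_convex K (mat_fun_family S V K)"
  unfolding matrix_convex_def
proof (intro allI subsetI)
  fix n G assume "G \<in> matrix_combinations K (mat_fun_family S V K) n"
  then obtain k \<eta> Y F where
    G: "G = (\<lambda>z. mat_sum n k (\<lambda>j. mat_adjoint (Y j) * F j z * Y j))"
    and Y: "\<And>j. j \<in> {1..k} \<Longrightarrow> Y j \<in> carrier_mat (\<eta> j) n"
    and YK: "\<And>j. j \<in> {1..k} \<Longrightarrow> elements_mat (Y j) \<subseteq> K"
    and F: "\<And>j. j \<in> {1..k} \<Longrightarrow> F j \<in> mat_fun_family S V K (\<eta> j)"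
    and one: "mat_sum n k (\<lambda>j. mat_adjoint (Y j) * Y j) = 1\<^sub>m n"
    unfolding matrix_combinations_def by blast
  have Fc: "F j z \<in> carrier_mat (\<eta> j) (\<eta> j)" if "j \<in> {1..k}" for j z
    using F[OF that] by (simp add: mat_fun_family_def rational_mat_fun_iff)
  have entry: "(\<lambda>z. G z $$ (r, c)) = (\<lambda>z. \<Sum>j=1..k. \<Sum>b<\<eta> j. \<Sum>a<\<eta> j.
      cnj (Y j $$ (a, r)) * Y j $$ (b, c) * F j z $$ (a, b))" if "r < n" "c < n" for r c
    unfolding G using Y Fc that by (intro ext matrix_combination_index) auto
  have "rational_fun K (\<lambda>z. G z $$ (r, c))" if rc: "r < n" "c < n" for r c
    unfolding entry[OF rc]
  proof (intro rational_fun_sum rational_fun_cmult)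
    fix j a b assume j: "j \<in> {1..k}" and "b \<in> {..<\<eta> j}" "a \<in> {..<\<eta> j}"
    then have ab: "a < \<eta> j" "b < \<eta> j" by auto
    have "Y j $$ (a, r) \<in> K" "Y j $$ (b, c) \<in> K"
      using YK[OF j] elements_matI[OF Y[OF j]] ab rc by blast+
    then show "cnj (Y j $$ (a, r)) * Y j $$ (b, c) \<in> K"
      by (simp add: mult cnj)
    show "rational_fun K (\<lambda>z. F j z $$ (a, b))"
      using F[OF j] ab by (simp add: mat_fun_family_def rational_mat_fun_iff)
  qed
  moreover have "(\<lambda>z. G z $$ (r, c)) analytic_on S" if rc: "r < n" "c < n" for r c
    unfolding entry[OF rc]
  proof (intro analytic_on_sum analytic_on_mult analytic_on_const)
    fix j a b assume "j \<in> {1..k}" "b \<in> {..<\<eta> j}" "a \<in> {..<\<eta> j}"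
    then show "(\<lambda>z. F j z $$ (a, b)) analytic_on S"
      using F[of j] by (simp add: mat_fun_family_def mat_analytic_on_def)
  qed
  moreover have "G z \<in> V n" if "z \<in> S" for z
  proof -
    have "Y j \<in> carrier_mat (\<eta> j) n \<and> F j z \<in> V (\<eta> j)" if "j \<in> {1..k}" for j
      using Y[OF that] F[OF that] \<open>z \<in> S\<close> by (simp add: mat_fun_family_def)
    then show ?thesis
      unfolding G using one by (rule V[unfolded matrix_convex_set_def, rule_format])
  qed
  moreover have "G z \<in> carrier_mat n n" for z
    by (simp add: G)
  ultimately show "G \<in> mat_fun_family S V K n"
    unfolding mat_fun_family_def rational_mat_fun_iff mat_analytic_on_def by blast
qed

lemma mat_fun_family_mono:
  assumes "K \<subseteq> L"
  shows "mat_fun_family S V K m \<subseteq> mat_fun_family S V L m"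
proof -
  have "rational_fun L f" if "rational_fun K f" for f
    using that assms unfolding rational_fun_def by (meson subset_trans)
  then show ?thesis
    by (auto simp: mat_fun_family_def rational_mat_fun_iff)
qed

lemma matrix_combinations_mono:
  assumes "\<And>m. \<F> m \<subseteq> \<G> m"
  shows "matrix_combinations K \<F> n \<subseteq> matrix_combinations K \<G> n"
proof
  fix G assume "G \<in> matrix_combinations K \<F> n"
  then obtain k \<eta> Y F where
    "G = (\<lambda>z. mat_sum n k (\<lambda>j. mat_adjoint (Y j) * F j z * Y j))"
    "\<forall>j\<in>{1..k}. \<eta> j \<in> {1..n} \<and> Y j \<in> carrier_mat (\<eta> j) n \<and> elements_mat (Y j) \<subseteq> K \<and>
      F j \<in> \<F> (\<eta> j)"
    "mat_sum n k (\<lambda>j. mat_adjoint (Y j) * Y j) = 1\<^sub>m n"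
    unfolding matrix_combinations_def by blast
  moreover from this(2) assms have "\<forall>j\<in>{1..k}. \<eta> j \<in> {1..n} \<and> Y j \<in> carrier_mat (\<eta> j) n \<and>
      elements_mat (Y j) \<subseteq> K \<and> F j \<in> \<G> (\<eta> j)"
    by blast
  ultimately show "G \<in> matrix_combinations K \<G> n"
    unfolding matrix_combinations_def by blast
qed

theorem proposition3p3:
  fixes \<F> :: "complex set \<Rightarrow> nat \<Rightarrow> (complex \<Rightarrow> complex mat) set"
  assumes "\<F> \<in> {positive_real, bounded_real, discrete_positive_real, discrete_bounded_real}"
  shows "(\<forall>\<nu>. matrix_combinations UNIV (\<F> \<real>) \<nu> \<subseteq> \<F> UNIV \<nu>) \<and>
         matrix_convex UNIV (\<F> UNIV) \<and>
         matrix_convex \<real> (\<F> \<real>)"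
proof -
  obtain S V where \<F>: "\<F> = mat_fun_family S V" and V: "matrix_convex_set V"
  proof -
    have "positive_real = mat_fun_family right_half_plane lyapunov_set"
      "bounded_real = mat_fun_family right_half_plane stein_set"
      "discrete_positive_real = mat_fun_family exterior_disc lyapunov_set"
      "discrete_bounded_real = mat_fun_family exterior_disc stein_set"
      by (auto simp: fun_eq_iff mat_fun_family_def positive_real_def bounded_real_def
          discrete_positive_real_def discrete_bounded_real_def)
    then show ?thesis
      using assms that matrix_convex_set_lyapunov matrix_convex_set_stein by auto
  qed
  have complex: "matrix_convex UNIV (\<F> UNIV)"
    unfolding \<F> by (rule conj_subsemiring.matrix_convex_mat_fun_family[OF _ V]) (unfold_locales, auto)
  have real: "matrix_convex \<real> (\<F> \<real>)"
    unfolding \<F> by (rule conj_subsemiring.matrix_convex_mat_fun_family[OF _ V])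
      (unfold_locales, auto simp: Reals_cnj_iff)
  have "matrix_combinations UNIV (\<F> \<real>) \<nu> \<subseteq> matrix_combinations UNIV (\<F> UNIV) \<nu>" for \<nu>
    unfolding \<F> by (intro matrix_combinations_mono mat_fun_family_mono) simp
  with complex real show ?thesis
    unfolding matrix_convex_def by blast
qed

end
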